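(* Assume the Schanuel Subset Conjecture (SSC) holds. Then: (i) Let $\omega\neq0$ be an algebraic number and $z=e^{\omega}$, with power tower ${}^1z=e^{\omega}$, ${}^{k+1}z=e^{\omega\cdot {}^kz}$. Then ${}^kz$ is transcendental for every $k\ge 2$, and in fact the numbers ${}^1z,{}^2z,{}^3z,\dots$ are algebraically independent over $\mathbb{Q}$. (ii) Let $\alpha$ be an irrational algebraic number, fix a logarithm $\log\alpha$ of $\alpha$ (so $e^{\log\alpha}=\alpha$), and define ${}^1\alpha=\alpha$, ${}^{k+1}\alpha=e^{{}^k\alpha\cdot\log\alpha}$. Then ${}^k\alpha$ is transcendental for every $k\ge2$, and the numbers ${}^2\alpha,{}^3\alpha,{}^4\alpha,\dots$ are algebraically independent over $\mathbb{Q}$. (iii) More generally, let $\alpha$ be an algebraic number that is not a rational integer, fix a logarithm $\log\alpha$ of $\alpha$, and define ${}^k\alpha$ as in (ii). Then ${}^m\alpha$ is transcendental for every $m\ge 3$, and the numbers $\log\alpha,{}^3\alpha,{}^4\alpha,{}^5\alpha,\dots$ are algebraically independent over $\mathbb{Q}$.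
   Context: $\overline{\mathbb{Q}}$ denotes the field of algebraic numbers. A set $X\subset\mathbb{C}$ is called $\overline{\mathbb{Q}}$-dependent on a set $Y\subset\mathbb{C}$ if $\overline{\mathbb{Q}}(X)\subset\overline{\mathbb{Q}}(Y)$. The Schanuel Subset Conjecture (SSC) is the statement: for every $n\ge1$ and all $\alpha_1,\dots,\alpha_n\in\mathbb{C}$ linearly independent over $\mathbb{Q}$, if the set $\{\alpha_1,\dots,\alpha_n,e^{\alpha_1},\dots,e^{\alpha_n}\}$ is $\overline{\mathbb{Q}}$-dependent on a subset $\{\beta_1,\dots,\beta_n\}$ of itself (with $n$ elements), then $\beta_1,\dots,\beta_n$ are algebraically independent over $\mathbb{Q}$. Power towers are evaluated from the top: ${}^kz=z^{z^{\cdot^{\cdot^{z}}}}$ ($k$ copies of $z$), where $z^w$ means $e^{w\log z}$ for the fixed logarithm of $z$ (for $z=e^{\omega}$ the logarithm $\omega$ is used). *)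

theory Defs
  imports
    "HOL-Algebra.Generated_Fields"
    "HOL-Algebra.Algebraic_Closure_Type"
    "HOL-Analysis.Analysis"
    "HOL-Library.Poly_Mapping"
begin

section \<open>Linear and algebraic independence over the rationals\<close>

definition rat_scale :: "rat \<Rightarrow> complex \<Rightarrow> complex" where
  "rat_scale q z = of_rat q * z"

lemma vector_space_rat_scale: "vector_space rat_scale"
  by unfold_locales (simp_all add: rat_scale_def algebra_simps of_rat_add of_rat_mult)

text \<open>Independence of a family, so repeated members are excluded.\<close>

definition rat_lin_indep_on :: "'i set \<Rightarrow> ('i \<Rightarrow> complex) \<Rightarrow> bool" where
  "rat_lin_indep_on I x \<longleftrightarrow> inj_on x I \<and> module.independent rat_scale (x ` I)"

text \<open>
  A polynomial over the rationals in indeterminates indexed by \<open>'i\<close> is a finitely supported map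
  from monomials to coefficients, and a monomial is a finitely supported map from indeterminates
  to exponents.
\<close>

type_synonym 'i rat_mpoly = "('i \<Rightarrow>\<^sub>0 nat) \<Rightarrow>\<^sub>0 rat"

definition mpoly_vars :: "'i rat_mpoly \<Rightarrow> 'i set" where
  "mpoly_vars p = (\<Union>m\<in>Poly_Mapping.keys p. Poly_Mapping.keys m)"

definition mpoly_eval :: "('i \<Rightarrow> complex) \<Rightarrow> 'i rat_mpoly \<Rightarrow> complex" where
  "mpoly_eval x p =
     (\<Sum>m\<in>Poly_Mapping.keys p. of_rat (Poly_Mapping.lookup p m) *
       (\<Prod>i\<in>Poly_Mapping.keys m. x i ^ Poly_Mapping.lookup m i))"

definition rat_alg_indep_on :: "'i set \<Rightarrow> ('i \<Rightarrow> complex) \<Rightarrow> bool" where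
  "rat_alg_indep_on I x \<longleftrightarrow>
     (\<forall>p :: 'i rat_mpoly. mpoly_vars p \<subseteq> I \<longrightarrow> mpoly_eval x p = 0 \<longrightarrow> p = 0)"

section \<open>The Schanuel Subset Conjecture\<close>

text \<open>The subfield of the complex numbers generated by all algebraic numbers together with \<open>A\<close>.\<close>

definition Qbar_adjoin :: "complex set \<Rightarrow> complex set" where
  "Qbar_adjoin A = generate_field ring_of_type_algebra ({z. algebraic z} \<union> A)"

definition Qbar_dependent :: "complex set \<Rightarrow> complex set \<Rightarrow> bool" where
  "Qbar_dependent A B \<longleftrightarrow> Qbar_adjoin A \<subseteq> Qbar_adjoin B"

definition Schanuel_Subset_Conjecture :: bool where
  "Schanuel_Subset_Conjecture \<longleftrightarrow>
     (\<forall>n::nat. \<forall>\<alpha> \<beta> :: nat \<Rightarrow> complex.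
        n \<ge> 1 \<longrightarrow>
        rat_lin_indep_on {1..n} \<alpha> \<longrightarrow>
        inj_on \<beta> {1..n} \<longrightarrow>
        \<beta> ` {1..n} \<subseteq> \<alpha> ` {1..n} \<union> (\<lambda>i. exp (\<alpha> i)) ` {1..n} \<longrightarrow>
        Qbar_dependent (\<alpha> ` {1..n} \<union> (\<lambda>i. exp (\<alpha> i)) ` {1..n}) (\<beta> ` {1..n}) \<longrightarrow>
        rat_alg_indep_on {1..n} \<beta>)"

section \<open>Power towers\<close>

text \<open>
  \<open>power_tower l k\<close> is the tower of height \<open>k\<close> over the base \<open>z = exp l\<close>, where powers of \<open>z\<close> are
  formed with the logarithm \<open>l\<close> (any branch). The base is determined by \<open>l\<close>, so it is not a
  separate argument. Starting with the empty tower 1 makes the tower of height 1 equal to \<open>z\<close>.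
\<close>

primrec power_tower :: "complex \<Rightarrow> nat \<Rightarrow> complex" where
  "power_tower l 0 = 1"
| "power_tower l (Suc k) = exp (l * power_tower l k)"

lemma power_tower_1: "exp l = z \<Longrightarrow> power_tower l 1 = z"
  by simp

end

theory Submission
  imports Defs
begin

text \<open>
  Write \<open>T\<^sub>k\<close> for the towers over \<open>exp l\<close>. If \<open>T\<^sub>1, \<dots>, T\<^sub>n\<^sub>-\<^sub>1\<close> are algebraically
  independent, then \<open>l, l T\<^sub>1, \<dots>, l T\<^sub>n\<^sub>-\<^sub>1\<close> are linearly independent over the rationals; when \<open>l\<close> is
  algebraic, these numbers and their exponentials \<open>T\<^sub>1, \<dots>, T\<^sub>n\<close> all lie in the field generated by
  \<open>T\<^sub>1, \<dots>, T\<^sub>n\<close> over the algebraic numbers, and the conjecture makes these \<open>n\<close> numbers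
  algebraically independent. When \<open>exp l\<close> is irrational algebraic, the same induction runs with
  \<open>l, T\<^sub>2, \<dots>, T\<^sub>n\<close> as generators. When \<open>exp l\<close> is rational but not an integer, \<open>l\<close> and \<open>l T\<^sub>1\<close> are
  dependent, but \<open>T\<^sub>2\<close> is irrational algebraic and takes over the role of \<open>T\<^sub>1\<close>.
\<close>

section \<open>Polynomial functions with rational coefficients\<close>

definition monomial_eval :: "('i \<Rightarrow> complex) \<Rightarrow> ('i \<Rightarrow>\<^sub>0 nat) \<Rightarrow> complex" where
  "monomial_eval x m = (\<Prod>i\<in>Poly_Mapping.keys m. x i ^ Poly_Mapping.lookup m i)"

lemma monomial_eval_superset:
  assumes "finite S" "Poly_Mapping.keys m \<subseteq> S"
  shows "monomial_eval x m = (\<Prod>i\<in>S. x i ^ Poly_Mapping.lookup m i)"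
  unfolding monomial_eval_def
  using assms by (intro prod.mono_neutral_left) (auto simp: in_keys_iff)

lemma monomial_eval_add: "monomial_eval x (m + n) = monomial_eval x m * monomial_eval x n"
proof -
  let ?S = "Poly_Mapping.keys m \<union> Poly_Mapping.keys n"
  have "monomial_eval x (m + n) = (\<Prod>i\<in>?S. x i ^ Poly_Mapping.lookup (m + n) i)"
    by (rule monomial_eval_superset) (auto dest: subsetD[OF keys_add])
  also have "\<dots> = (\<Prod>i\<in>?S. x i ^ Poly_Mapping.lookup m i) * (\<Prod>i\<in>?S. x i ^ Poly_Mapping.lookup n i)"
    by (simp add: lookup_add power_add prod.distrib)
  also have "\<dots> = monomial_eval x m * monomial_eval x n"
    by (simp add: monomial_eval_superset[of ?S])
  finally show ?thesis .
qed

text \<open>Padding with monomials of coefficient zero changes nothing; sums and products of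
  polynomials can then be compared over a common set of monomials.\<close>

lemma mpoly_eval_superset:
  assumes "finite S" "Poly_Mapping.keys p \<subseteq> S"
  shows "mpoly_eval x p = (\<Sum>m\<in>S. of_rat (Poly_Mapping.lookup p m) * monomial_eval x m)"
  unfolding mpoly_eval_def monomial_eval_def
  using assms by (intro sum.mono_neutral_left) (auto simp: in_keys_iff)

lemma mpoly_eval_single:
  "mpoly_eval x (Poly_Mapping.single m c) = of_rat c * monomial_eval x m"
  by (subst mpoly_eval_superset[of "{m}"]) auto

lemma mpoly_eval_add: "mpoly_eval x (p + q) = mpoly_eval x p + mpoly_eval x q"
proof -
  let ?S = "Poly_Mapping.keys p \<union> Poly_Mapping.keys q"
  have "mpoly_eval x (p + q) = (\<Sum>m\<in>?S. of_rat (Poly_Mapping.lookup (p + q) m) * monomial_eval x m)"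
    by (rule mpoly_eval_superset) (auto dest: subsetD[OF keys_add])
  also have "\<dots> = mpoly_eval x p + mpoly_eval x q"
    by (simp add: mpoly_eval_superset[of ?S] lookup_add of_rat_add distrib_right sum.distrib)
  finally show ?thesis .
qed

lemma mpoly_eval_sum: "mpoly_eval x (\<Sum>a\<in>A. f a) = (\<Sum>a\<in>A. mpoly_eval x (f a))"
  by (induction A rule: infinite_finite_induct)
    (simp_all add: mpoly_eval_add, simp_all add: mpoly_eval_def)

lemma poly_mapping_eq_sum_single:
  "p = (\<Sum>m\<in>Poly_Mapping.keys p. Poly_Mapping.single m (Poly_Mapping.lookup p m))"
  by (rule poly_mapping_eqI) (auto simp: lookup_sum lookup_single when_def in_keys_iff)

lemma mpoly_eval_mult: "mpoly_eval x (p * q) = mpoly_eval x p * mpoly_eval x q"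
proof -
  have "p * q = (\<Sum>m\<in>Poly_Mapping.keys p. \<Sum>n\<in>Poly_Mapping.keys q.
      Poly_Mapping.single (m + n) (Poly_Mapping.lookup p m * Poly_Mapping.lookup q n))"
    by (subst (1) poly_mapping_eq_sum_single[of p], subst (1) poly_mapping_eq_sum_single[of q])
      (simp add: sum_product mult_single)
  then have "mpoly_eval x (p * q) = (\<Sum>m\<in>Poly_Mapping.keys p. \<Sum>n\<in>Poly_Mapping.keys q.
      of_rat (Poly_Mapping.lookup p m) * monomial_eval x m *
      (of_rat (Poly_Mapping.lookup q n) * monomial_eval x n))"
    by (simp add: mpoly_eval_sum mpoly_eval_single monomial_eval_add of_rat_mult mult_ac)
  also have "\<dots> = mpoly_eval x p * mpoly_eval x q"
    by (simp add: mpoly_eval_superset[OF finite_keys order_refl] sum_product)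
  finally show ?thesis .
qed

text \<open>One polynomial has to serve every assignment \<open>x\<close>. This uniformity lets a
  relation at a single independent point force an identity, while closure lemmas replace explicit
  polynomials.\<close>

definition rat_polyfun_on :: "'i set \<Rightarrow> (('i \<Rightarrow> complex) \<Rightarrow> complex) \<Rightarrow> bool" where
  "rat_polyfun_on I f \<longleftrightarrow> (\<exists>p. mpoly_vars p \<subseteq> I \<and> (\<forall>x. mpoly_eval x p = f x))"

lemma rat_polyfun_on_const: "rat_polyfun_on I (\<lambda>_. of_rat c)"
  unfolding rat_polyfun_on_def
  by (rule exI[of _ "Poly_Mapping.single 0 c"])
    (auto simp: mpoly_vars_def mpoly_eval_single monomial_eval_def)

lemma rat_polyfun_on_var: "i \<in> I \<Longrightarrow> rat_polyfun_on I (\<lambda>x. x i)"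
  unfolding rat_polyfun_on_def
  by (rule exI[of _ "Poly_Mapping.single (Poly_Mapping.single i 1) 1"])
    (auto simp: mpoly_vars_def mpoly_eval_single monomial_eval_def)

lemma rat_polyfun_on_add:
  assumes "rat_polyfun_on I f" "rat_polyfun_on I g"
  shows "rat_polyfun_on I (\<lambda>x. f x + g x)"
proof -
  obtain p q where pq: "mpoly_vars p \<subseteq> I" "mpoly_vars q \<subseteq> I"
    "\<And>x. mpoly_eval x p = f x" "\<And>x. mpoly_eval x q = g x"
    using assms unfolding rat_polyfun_on_def by blast
  have "mpoly_vars (p + q) \<subseteq> mpoly_vars p \<union> mpoly_vars q"
    unfolding mpoly_vars_def using keys_add[of p q] by blast
  then show ?thesis
    unfolding rat_polyfun_on_def using pq
    by (intro exI[of _ "p + q"]) (auto simp: mpoly_eval_add)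
qed

lemma rat_polyfun_on_mult:
  assumes "rat_polyfun_on I f" "rat_polyfun_on I g"
  shows "rat_polyfun_on I (\<lambda>x. f x * g x)"
proof -
  obtain p q where pq: "mpoly_vars p \<subseteq> I" "mpoly_vars q \<subseteq> I"
    "\<And>x. mpoly_eval x p = f x" "\<And>x. mpoly_eval x q = g x"
    using assms unfolding rat_polyfun_on_def by blast
  have "mpoly_vars (p * q) \<subseteq> mpoly_vars p \<union> mpoly_vars q"
  proof
    fix i assume "i \<in> mpoly_vars (p * q)"
    then obtain m n where "m \<in> Poly_Mapping.keys p" "n \<in> Poly_Mapping.keys q"
      "i \<in> Poly_Mapping.keys (m + n)"
      unfolding mpoly_vars_def using keys_mult[of p q] by blast
    then show "i \<in> mpoly_vars p \<union> mpoly_vars q"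
      unfolding mpoly_vars_def using keys_add[of m n] by blast
  qed
  then show ?thesis
    unfolding rat_polyfun_on_def using pq
    by (intro exI[of _ "p * q"]) (auto simp: mpoly_eval_mult)
qed

lemma rat_polyfun_on_sum:
  "(\<And>a. a \<in> A \<Longrightarrow> rat_polyfun_on I (f a)) \<Longrightarrow> rat_polyfun_on I (\<lambda>x. \<Sum>a\<in>A. f a x)"
  using rat_polyfun_on_const[of I 0]
  by (induction A rule: infinite_finite_induct) (auto intro: rat_polyfun_on_add)

lemma rat_polyfun_on_power: "rat_polyfun_on I f \<Longrightarrow> rat_polyfun_on I (\<lambda>x. f x ^ n)"
  using rat_polyfun_on_const[of I 1]
  by (induction n) (auto intro: rat_polyfun_on_mult)

text \<open>The polynomial behind \<open>f\<close> vanishes at the independent point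
  \<open>x\<close>, so it is the zero polynomial, and \<open>f\<close> vanishes everywhere.\<close>

lemma rat_alg_indep_on_polyfun_eq_0:
  assumes "rat_alg_indep_on I x" "rat_polyfun_on I f" "f x = 0"
  shows "f y = 0"
proof -
  obtain p where p: "mpoly_vars p \<subseteq> I" "\<And>x. mpoly_eval x p = f x"
    using assms(2) unfolding rat_polyfun_on_def by blast
  then have "p = 0"
    using assms unfolding rat_alg_indep_on_def by metis
  then show ?thesis
    using p(2)[of y] by (simp add: mpoly_eval_def)
qed

section \<open>Consequences of algebraic independence\<close>

text \<open>If the affine form \<open>F\<close> takes at \<open>x\<close> a value that is a root of
  a nonzero rational polynomial \<open>P\<close>, then \<open>P\<close> composed with
  \<open>F\<close> vanishes identically. With \<open>q k\<close> nonzero, \<open>F\<close> is onto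
  the complex numbers, so \<open>P\<close> would be zero. As 0 is algebraic, this also yields linear
  independence together with 1.\<close>

lemma rat_alg_indep_on_affine_algebraic:
  assumes indep: "rat_alg_indep_on I x" and J: "finite J" "J \<subseteq> I"
    and alg: "algebraic (of_rat b + (\<Sum>j\<in>J. of_rat (q j) * x j))"
    and k: "k \<in> J"
  shows "q k = 0"
proof (rule ccontr)
  assume qk: "q k \<noteq> 0"
  define F where "F = (\<lambda>y :: _ \<Rightarrow> complex. of_rat b + (\<Sum>j\<in>J. of_rat (q j) * y j))"
  obtain P where P: "\<And>i. coeff P i \<in> \<rat>" "P \<noteq> 0" "poly P (F x) = 0"
    using alg unfolding algebraic_altdef F_def by blast
  have "\<forall>i. \<exists>c. coeff P i = of_rat c"
    using P(1) by (auto simp: Rats_def)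
  then obtain r where r: "\<And>i. coeff P i = of_rat (r i)"
    by metis
  have "rat_polyfun_on I F"
    unfolding F_def
    by (rule rat_polyfun_on_add[OF rat_polyfun_on_const], rule rat_polyfun_on_sum,
        rule rat_polyfun_on_mult[OF rat_polyfun_on_const], rule rat_polyfun_on_var,
        rule subsetD[OF J(2)])
  then have "rat_polyfun_on I (\<lambda>y. poly P (F y))"
    unfolding poly_altdef r
    by (intro rat_polyfun_on_sum rat_polyfun_on_mult[OF rat_polyfun_on_const rat_polyfun_on_power])
  then have zero: "poly P (F y) = 0" for y
    by (rule rat_alg_indep_on_polyfun_eq_0[OF indep, where f = "\<lambda>y. poly P (F y)"]) (rule P(3))
  have "poly P t = 0" for t
  proof -
    \<comment> \<open>All coordinates but \<open>k\<close> are set to 0, and \<open>F = t\<close> is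
      solved for coordinate \<open>k\<close>.\<close>
    have "(\<Sum>j\<in>J. of_rat (q j) * ((\<lambda>_. 0)(k := (t - of_rat b) / of_rat (q k))) j) = t - of_rat b"
      using J(1) k qk by (subst sum.remove[of _ k]) auto
    then have "F ((\<lambda>_. 0)(k := (t - of_rat b) / of_rat (q k))) = t"
      by (simp add: F_def)
    with zero show ?thesis by metis
  qed
  then show False
    using P(2) poly_all_0_iff_0 by blast
qed

lemma rat_alg_indep_on_imp_not_algebraic:
  assumes "rat_alg_indep_on I x" "i \<in> I"
  shows "\<not> algebraic (x i)"
  using rat_alg_indep_on_affine_algebraic[of I x "{i}" 0 "\<lambda>_. 1" i] assms by auto

lemma rat_alg_indep_on_imp_inj_on:
  assumes "rat_alg_indep_on I x"
  shows "inj_on x I"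
proof (rule inj_onI, rule ccontr)
  fix i j assume ij: "i \<in> I" "j \<in> I" "x i = x j" "i \<noteq> j"
  then show False
    using rat_alg_indep_on_affine_algebraic[of I x "{i, j}" 0 "(\<lambda>_. 1)(j := -1)" i] assms
    by (simp add: of_rat_minus)
qed

text \<open>Renaming indeterminates along \<open>f\<close> turns a relation among the
  \<open>y j\<close> into one among the \<open>x i\<close>. Since \<open>f\<close> is injective on
  \<open>J\<close>, distinct monomials stay distinct and no coefficients merge, so the original
  polynomial is zero if the renamed one is.\<close>

lemma rat_alg_indep_on_reindex:
  fixes x :: "'i \<Rightarrow> complex" and y :: "'j \<Rightarrow> complex"
  assumes indep: "rat_alg_indep_on I x" and inj: "inj_on f J" and sub: "f ` J \<subseteq> I"
    and eq: "\<And>j. j \<in> J \<Longrightarrow> y j = x (f j)"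
  shows "rat_alg_indep_on J y"
  unfolding rat_alg_indep_on_def
proof (intro allI impI)
  fix p :: "'j rat_mpoly"
  assume vars: "mpoly_vars p \<subseteq> J" and zero: "mpoly_eval y p = 0"
  \<comment> \<open>\<open>M m\<close> is the renamed monomial and \<open>P\<close> the renamed
    polynomial.\<close>
  define M where "M m = (\<Sum>j\<in>Poly_Mapping.keys m. Poly_Mapping.single (f j) (Poly_Mapping.lookup m j))"
    for m :: "'j \<Rightarrow>\<^sub>0 nat"
  define P where "P = (\<Sum>m\<in>Poly_Mapping.keys p. Poly_Mapping.single (M m) (Poly_Mapping.lookup p m))"
  have keysJ: "Poly_Mapping.keys m \<subseteq> J" if "m \<in> Poly_Mapping.keys p" for m
    using vars that unfolding mpoly_vars_def by blast
  have lookup_M: "Poly_Mapping.lookup (M m) (f j) = Poly_Mapping.lookup m j"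
    if "m \<in> Poly_Mapping.keys p" "j \<in> J" for m j
  proof -
    have "Poly_Mapping.lookup (M m) (f j) =
        (\<Sum>i\<in>Poly_Mapping.keys m. if i = j then Poly_Mapping.lookup m j else 0)"
      unfolding M_def lookup_sum
      using inj_onD[OF inj] keysJ[OF that(1)] that(2)
      by (intro sum.cong) (auto simp: lookup_single when_def)
    then show ?thesis by (simp add: in_keys_iff)
  qed
  have keys_M: "Poly_Mapping.keys (M m) \<subseteq> f ` Poly_Mapping.keys m" for m
    unfolding M_def using keys_sum[of _ "Poly_Mapping.keys m"]
    by (fastforce split: if_splits)
  have inj_M: "inj_on M (Poly_Mapping.keys p)"
  proof (intro inj_onI poly_mapping_eqI)
    fix m n j assume mn: "m \<in> Poly_Mapping.keys p" "n \<in> Poly_Mapping.keys p" "M m = M n"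
    show "Poly_Mapping.lookup m j = Poly_Mapping.lookup n j"
    proof (cases "j \<in> J")
      case True then show ?thesis using mn lookup_M by metis
    next
      case False
      then have "j \<notin> Poly_Mapping.keys m" "j \<notin> Poly_Mapping.keys n"
        using mn keysJ by blast+
      then show ?thesis by (simp add: in_keys_iff)
    qed
  qed
  have lookup_P: "Poly_Mapping.lookup P (M m) = Poly_Mapping.lookup p m"
    if "m \<in> Poly_Mapping.keys p" for m
  proof -
    have "Poly_Mapping.lookup P (M m) =
        (\<Sum>n\<in>Poly_Mapping.keys p. if n = m then Poly_Mapping.lookup p m else 0)"
      unfolding P_def lookup_sum
      using inj_onD[OF inj_M] that by (intro sum.cong) (auto simp: lookup_single when_def)
    then show ?thesis using that by simp
  qed
  have eval_M: "monomial_eval x (M m) = monomial_eval y m" if "m \<in> Poly_Mapping.keys p" for m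
  proof -
    have "monomial_eval x (M m) =
        (\<Prod>i\<in>f ` Poly_Mapping.keys m. x i ^ Poly_Mapping.lookup (M m) i)"
      by (rule monomial_eval_superset[OF _ keys_M]) simp
    also have "\<dots> = (\<Prod>j\<in>Poly_Mapping.keys m. x (f j) ^ Poly_Mapping.lookup (M m) (f j))"
      using inj_on_subset[OF inj keysJ[OF that]] by (simp add: prod.reindex)
    also have "\<dots> = monomial_eval y m"
      unfolding monomial_eval_def using keysJ[OF that] lookup_M[OF that] eq
      by (intro prod.cong) auto
    finally show ?thesis .
  qed
  have "mpoly_eval x P = (\<Sum>m\<in>Poly_Mapping.keys p. of_rat (Poly_Mapping.lookup p m) * monomial_eval y m)"
    by (simp add: P_def mpoly_eval_sum mpoly_eval_single eval_M)
  also have "\<dots> = 0"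
    using zero by (simp add: mpoly_eval_def monomial_eval_def)
  finally have "mpoly_eval x P = 0" .
  moreover have "mpoly_vars P \<subseteq> I"
  proof
    fix i assume "i \<in> mpoly_vars P"
    then obtain n where n: "n \<in> Poly_Mapping.keys P" "i \<in> Poly_Mapping.keys n"
      unfolding mpoly_vars_def by blast
    then obtain m where "m \<in> Poly_Mapping.keys p" "n = M m"
      unfolding P_def using keys_sum[of _ "Poly_Mapping.keys p"] by (fastforce split: if_splits)
    with n(2) keys_M keysJ sub show "i \<in> I" by blast
  qed
  ultimately have "P = 0"
    using indep unfolding rat_alg_indep_on_def by blast
  then have "Poly_Mapping.lookup p m = 0" for m
    using lookup_P[of m] by (cases "m \<in> Poly_Mapping.keys p") (simp_all add: in_keys_iff)
  then show "p = 0" by (intro poly_mapping_eqI) simp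
qed

text \<open>A polynomial involves only finitely many indeterminates.\<close>

lemma rat_alg_indep_on_atLeast_1:
  assumes "\<And>n. rat_alg_indep_on {1..n::nat} x"
  shows "rat_alg_indep_on {1..} x"
  unfolding rat_alg_indep_on_def
proof (intro allI impI)
  fix p :: "nat rat_mpoly"
  assume p: "mpoly_vars p \<subseteq> {1..}" "mpoly_eval x p = 0"
  have "finite (mpoly_vars p)" unfolding mpoly_vars_def by simp
  then obtain n where "mpoly_vars p \<subseteq> {..n}" using finite_nat_iff_bounded_le by blast
  with p(1) have "mpoly_vars p \<subseteq> {1..n}" by auto
  with assms p(2) show "p = 0" unfolding rat_alg_indep_on_def by blast
qed

section \<open>Linear independence and the field generated over the algebraic numbers\<close>

lemma rat_lin_indep_onI:
  assumes fin: "finite I"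
    and zero: "\<And>q i. (\<Sum>i\<in>I. of_rat (q i) * x i) = 0 \<Longrightarrow> i \<in> I \<Longrightarrow> q i = 0"
  shows "rat_lin_indep_on I x"
proof -
  interpret vector_space rat_scale by (rule vector_space_rat_scale)
  have inj: "inj_on x I"
  proof (rule inj_onI, rule ccontr)
    fix i j assume ij: "i \<in> I" "j \<in> I" "x i = x j" "i \<noteq> j"
    \<comment> \<open>A repeated value is itself a nontrivial relation, so the criterion on
      coefficients also excludes repetitions.\<close>
    let ?q = "(\<lambda>_. 0)(i := 1, j := -1) :: _ \<Rightarrow> rat"
    have "(\<Sum>k\<in>I. of_rat (?q k) * x k) = (\<Sum>k\<in>{i, j}. of_rat (?q k) * x k)"
      using fin ij by (intro sum.mono_neutral_right) auto
    also have "\<dots> = 0" using ij by (simp add: of_rat_minus)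
    finally show False using zero[of ?q i] ij by simp
  qed
  have "independent (x ` I)"
  proof (rule independent_if_scalars_zero)
    fix f v assume f: "(\<Sum>v\<in>x ` I. rat_scale (f v) v) = 0" and "v \<in> x ` I"
    then show "f v = 0"
      using zero[of "\<lambda>i. f (x i)"] inj by (auto simp: sum.reindex rat_scale_def)
  qed (simp add: fin)
  with inj show ?thesis unfolding rat_lin_indep_on_def by simp
qed

lemma algebraic_in_Qbar_adjoin: "algebraic z \<Longrightarrow> z \<in> Qbar_adjoin A"
  unfolding Qbar_adjoin_def by (rule generate_field.incl) simp

lemma subset_Qbar_adjoin: "z \<in> A \<Longrightarrow> z \<in> Qbar_adjoin A"
  unfolding Qbar_adjoin_def by (rule generate_field.incl) simp

lemma mult_in_Qbar_adjoin: "y \<in> Qbar_adjoin A \<Longrightarrow> z \<in> Qbar_adjoin A \<Longrightarrow> y * z \<in> Qbar_adjoin A"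
  unfolding Qbar_adjoin_def
  using generate_field.eng_mult[of y ring_of_type_algebra _ z]
  by (simp add: ring_of_type_algebra_def)

lemma Qbar_adjoin_minimal:
  assumes "A \<subseteq> Qbar_adjoin B"
  shows "Qbar_adjoin A \<subseteq> Qbar_adjoin B"
proof
  fix z assume "z \<in> Qbar_adjoin A"
  then show "z \<in> Qbar_adjoin B"
    unfolding Qbar_adjoin_def
  proof induction
    case (incl h)
    with assms show ?case
      unfolding Qbar_adjoin_def by (auto intro: generate_field.incl)
  qed (auto intro: generate_field.intros)
qed

section \<open>The inductive use of the conjecture\<close>

text \<open>Induction on \<open>n\<close>: independence of the earlier \<open>b i\<close> gives
  linear independence of one more \<open>a i\<close>, and \<open>gen\<close> makes all these numbers
  and their exponentials dependent on the selected \<open>b i\<close>. The conjecture then applies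
  once the new \<open>b\<close> value is known to differ from the earlier ones; \<open>c\<close>
  serves to show this.\<close>

lemma SSC_imp_alg_indep:
  fixes a b :: "nat \<Rightarrow> complex"
  assumes SSC: Schanuel_Subset_Conjecture
    and lin: "\<And>n. n \<ge> 1 \<Longrightarrow> rat_alg_indep_on {1..<n} b \<Longrightarrow> rat_lin_indep_on {1..n} a"
    and mem: "\<And>n. n \<ge> 1 \<Longrightarrow> b n = a n \<or> b n = exp (a n)"
    and gen: "\<And>n. n \<ge> 1 \<Longrightarrow> {a n, exp (a n)} \<subseteq> Qbar_adjoin (b ` {1..n})"
    and c: "algebraic c" "c = a 1 \<or> c = exp (a 1)"
  shows "rat_alg_indep_on {1..} b"
proof (rule rat_alg_indep_on_atLeast_1)
  fix n show "rat_alg_indep_on {1..n} b"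
  proof (induction n)
    case 0
    \<comment> \<open>Without indeterminates only the constant monomial remains, and its coefficient
      is the value.\<close>
    show ?case
      unfolding rat_alg_indep_on_def
    proof (intro allI impI)
      fix p :: "nat rat_mpoly"
      assume p: "mpoly_vars p \<subseteq> {1..0}" "mpoly_eval b p = 0"
      then have "Poly_Mapping.keys p \<subseteq> {0}" by (auto simp: mpoly_vars_def)
      then have "of_rat (Poly_Mapping.lookup p 0) = (0::complex)"
        using p(2) mpoly_eval_superset[of "{0}" p b] by (simp add: monomial_eval_def)
      then have "Poly_Mapping.lookup p m = 0" for m
        using \<open>Poly_Mapping.keys p \<subseteq> {0}\<close> by (cases "m = 0") (auto simp: in_keys_iff)
      then show "p = 0" by (intro poly_mapping_eqI) simp
    qed
  next
    case (Suc n)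
    define N where "N = Suc n"
    have N: "N \<ge> 1" "{1..<N} = {1..n}" "{1..N} = insert N {1..n}" "N \<notin> {1..n}"
      by (auto simp: N_def)
    have inj: "inj_on b {1..n}" by (rule rat_alg_indep_on_imp_inj_on[OF Suc.IH])
    let ?G = "a ` {1..N} \<union> (\<lambda>i. exp (a i)) ` {1..N}"
    \<comment> \<open>\<open>B\<close> is left arbitrary because the conjecture is applied to two
      selections: \<open>b\<close> itself and \<open>b\<close> with one value exchanged for
      \<open>c\<close>.\<close>
    have G_sub: "?G \<subseteq> Qbar_adjoin B" if B: "b ` {1..N} \<subseteq> Qbar_adjoin B" for B
    proof -
      have "{a i, exp (a i)} \<subseteq> Qbar_adjoin B" if i: "i \<in> {1..N}" for i
      proof -
        have "b ` {1..i} \<subseteq> Qbar_adjoin B" using B i by fastforce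
        moreover have "{a i, exp (a i)} \<subseteq> Qbar_adjoin (b ` {1..i})"
          using i by (intro gen) simp
        ultimately show ?thesis
          using Qbar_adjoin_minimal by (meson order_trans)
      qed
      then show ?thesis by blast
    qed
    have SSC_N: "rat_alg_indep_on {1..N} b'"
      if "inj_on b' {1..N}" "b' ` {1..N} \<subseteq> ?G" "b ` {1..N} \<subseteq> Qbar_adjoin (b' ` {1..N})" for b'
    proof -
      have "Qbar_dependent ?G (b' ` {1..N})"
        unfolding Qbar_dependent_def by (intro Qbar_adjoin_minimal G_sub that(3))
      with SSC N(1) lin[OF N(1)] that(1,2) show ?thesis
        unfolding Schanuel_Subset_Conjecture_def using Suc.IH N(2) by simp
    qed
    have b_G: "b i \<in> ?G" if "i \<in> {1..N}" for i
      using mem[of i] that by auto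
    have "b N \<notin> b ` {1..n}"
    proof
      assume rep: "b N \<in> b ` {1..n}"
      \<comment> \<open>A repeated value is replaced by the algebraic number \<open>c\<close>, which the conjecture would
        then declare transcendental.\<close>
      let ?b = "b(N := c)"
      have img: "?b ` {1..N} = insert c (b ` {1..n})"
        using N(3,4) by auto
      have "c \<notin> b ` {1..n}"
        using c(1) rat_alg_indep_on_imp_not_algebraic[OF Suc.IH] by auto
      moreover have "?b ` {1..n} = b ` {1..n}"
        using N(4) by (intro image_cong) auto
      moreover have "inj_on ?b {1..n}"
        using inj N(4) by (subst inj_on_cong[of _ _ b]) auto
      ultimately have "inj_on ?b {1..N}"
        unfolding N(3) using N(4) by simp
      moreover have "?b ` {1..N} \<subseteq> ?G"
      proof -
        have "1 \<in> {1..N}" using N(1) by simp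
        then have "c \<in> ?G" using c(2) by blast
        moreover have "b ` {1..n} \<subseteq> ?G"
          using b_G unfolding N(3) by (intro image_subsetI) blast
        ultimately show ?thesis unfolding img by blast
      qed
      \<comment> \<open>The overwritten value \<open>b N\<close> also occurs at an earlier index, so
        no generator is lost.\<close>
      moreover have "b ` {1..N} \<subseteq> Qbar_adjoin (?b ` {1..N})"
        unfolding img using rep N(3) by (auto intro!: subset_Qbar_adjoin)
      ultimately have "rat_alg_indep_on {1..N} ?b" by (rule SSC_N)
      from rat_alg_indep_on_imp_not_algebraic[OF this, of N] c(1) N show False by simp
    qed
    then have "inj_on b {1..N}" unfolding N(3) using inj N(4) by simp
    moreover have "b ` {1..N} \<subseteq> ?G"
      using b_G by (rule image_subsetI)
    moreover have "b ` {1..N} \<subseteq> Qbar_adjoin (b ` {1..N})"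
      by (auto intro: subset_Qbar_adjoin)
    ultimately have "rat_alg_indep_on {1..N} b" by (rule SSC_N)
    then show ?case by (simp add: N_def)
  qed
qed

section \<open>Power towers\<close>

lemma sum_atLeast_atMost_head_shift:
  fixes f :: "nat \<Rightarrow> complex"
  assumes "m \<le> n"
  shows "(\<Sum>i=m..n. f i) = f m + (\<Sum>j=m..<n. f (Suc j))"
  using sum.atLeast_Suc_atMost[OF assms, of f] sum.shift_bounds_Suc_ivl[of f m n]
  by (simp only: atLeastLessThanSuc_atLeastAtMost)

text \<open>The exponents are \<open>w\<close> times the towers of heights 0, 1, 2, ..., and the
  selected numbers are their exponentials. Dividing a linear relation by \<open>w\<close> leaves an
  affine relation between the lower towers.\<close>

lemma SSC_tower_algebraic_exponent:
  assumes SSC: Schanuel_Subset_Conjecture and w: "algebraic w" "w \<noteq> 0"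
  shows "rat_alg_indep_on {1..} (power_tower w)"
proof (rule SSC_imp_alg_indep[OF SSC, where a = "\<lambda>n. w * power_tower w (n - 1)" and c = w])
  let ?T = "power_tower w"
  fix n :: nat assume n: "n \<ge> 1"
  show "?T n = w * ?T (n - 1) \<or> ?T n = exp (w * ?T (n - 1))"
    using n by (cases n) auto
  show "{w * ?T (n - 1), exp (w * ?T (n - 1))} \<subseteq> Qbar_adjoin (?T ` {1..n})"
  proof -
    have "exp (w * ?T (n - 1)) = ?T n"
      using n by (cases n) auto
    \<comment> \<open>For \<open>n = 1\<close> this is the empty tower 1, which is
      algebraic.\<close>
    moreover have "?T (n - 1) \<in> Qbar_adjoin (?T ` {1..n})"
      using n by (cases "n = 1") (auto intro: algebraic_in_Qbar_adjoin subset_Qbar_adjoin)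
    ultimately show ?thesis
      using n w(1) by (auto intro: mult_in_Qbar_adjoin algebraic_in_Qbar_adjoin subset_Qbar_adjoin)
  qed
  show "rat_lin_indep_on {1..n} (\<lambda>i. w * ?T (i - 1))" if indep: "rat_alg_indep_on {1..<n} ?T"
  proof (rule rat_lin_indep_onI)
    fix q i assume zero: "(\<Sum>i=1..n. of_rat (q i) * (w * ?T (i - 1))) = 0" and i: "i \<in> {1..n}"
    let ?s = "\<Sum>j=1..<n. of_rat (q (Suc j)) * ?T j"
    have "w * (of_rat (q 1) + ?s) = 0"
      using zero unfolding sum_atLeast_atMost_head_shift[OF n]
      by (simp add: sum_distrib_left algebra_simps)
    then have sum0: "of_rat (q 1) + ?s = 0" using w(2) by simp
    have q: "q (Suc j) = 0" if "j \<in> {1..<n}" for j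
      by (rule rat_alg_indep_on_affine_algebraic[OF indep _ order_refl, of "q 1" "\<lambda>j. q (Suc j)"])
        (use that sum0 in auto)
    then have "?s = 0" by (intro sum.neutral) auto
    with sum0 have "q 1 = 0" by simp
    moreover have "q i = 0" if "i \<noteq> 1"
    proof -
      have "i - 1 \<in> {1..<n}" using that i by auto
      from q[OF this] show ?thesis using i by simp
    qed
    ultimately show "q i = 0" by blast
  qed simp
qed (use w in auto)

text \<open>The sequence \<open>U\<close> is abstract so that it can start at height 1 for an
  irrational base and at height 2 for a rational one. The exponents are
  \<open>l, l * U 1, l * U 2, ...\<close>; slot 1 of the selection holds \<open>l\<close>, since
  \<open>exp l\<close> is algebraic, and the later slots hold \<open>U 2, U 3, ...\<close>.\<close>

lemma SSC_tower_irrational_start: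
  fixes U :: "nat \<Rightarrow> complex"
  assumes SSC: Schanuel_Subset_Conjecture
    and l: "algebraic (exp l)" "l \<noteq> 0"
    and U1: "algebraic (U 1)" "U 1 \<notin> \<rat>"
    and U: "\<And>k. k \<ge> 1 \<Longrightarrow> U (Suc k) = exp (l * U k)"
  shows "rat_alg_indep_on {1..} (\<lambda>k. if k = 1 then l else U k)"
proof (rule SSC_imp_alg_indep[OF SSC, where a = "\<lambda>n. if n = 1 then l else l * U (n - 1)"
      and c = "exp l"])
  let ?a = "\<lambda>n. if n = 1 then l else l * U (n - 1)"
  let ?b = "\<lambda>k::nat. if k = 1 then l else U k"
  fix n :: nat assume n: "n \<ge> 1"
  have exp_a: "exp (?a n) = U n" if "n \<noteq> 1"
    using that n U[of "n - 1"] by simp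
  show "?b n = ?a n \<or> ?b n = exp (?a n)"
    using exp_a by auto
  show "{?a n, exp (?a n)} \<subseteq> Qbar_adjoin (?b ` {1..n})"
  proof (cases "n = 1")
    case True
    then show ?thesis using l by (auto intro: algebraic_in_Qbar_adjoin subset_Qbar_adjoin)
  next
    case False
    define B where "B = ?b ` {1..n}"
    have b: "?b k \<in> Qbar_adjoin B" if "k \<in> {1..n}" for k
      unfolding B_def using that by (intro subset_Qbar_adjoin imageI)
    have "U (n - 1) \<in> Qbar_adjoin B"
    proof (cases "n = 2")
      case True
      then show ?thesis using U1 by (auto intro: algebraic_in_Qbar_adjoin)
    next
      case n2: False
      with n False have "n - 1 \<in> {1..n}" "n - 1 \<noteq> 1" by auto
      then show ?thesis using b[of "n - 1"] by simp
    qed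
    moreover have "l \<in> Qbar_adjoin B"
      using b[of 1] n by simp
    moreover have "U n \<in> Qbar_adjoin B"
      using b[of n] n False by simp
    ultimately show ?thesis
      using False exp_a[OF False] unfolding B_def[symmetric] by (simp add: mult_in_Qbar_adjoin)
  qed
  show "rat_lin_indep_on {1..n} ?a" if indep: "rat_alg_indep_on {1..<n} ?b"
  proof (rule rat_lin_indep_onI)
    fix q i assume zero: "(\<Sum>i=1..n. of_rat (q i) * ?a i) = 0" and i: "i \<in> {1..n}"
    show "q i = 0"
    proof (cases "n = 1")
      case True
      then show ?thesis using zero i l by simp
    next
      case False
      with n have n2: "2 \<le> n" by simp
      \<comment> \<open>The sum starts at 2: the algebraic \<open>U 1\<close> is kept apart, and
        slot 1 of \<open>?b\<close> is \<open>l\<close>.\<close>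
      let ?s = "\<Sum>j=2..<n. of_rat (q (Suc j)) * U j"
      have "(\<Sum>i=1..n. of_rat (q i) * ?a i) =
          of_rat (q 1) * ?a 1 + (\<Sum>j=1..<n. of_rat (q (Suc j)) * ?a (Suc j))"
        by (rule sum_atLeast_atMost_head_shift[OF n])
      also have "(\<Sum>j=1..<n. of_rat (q (Suc j)) * ?a (Suc j)) = (\<Sum>j=1..<n. of_rat (q (Suc j)) * (l * U j))"
        by (intro sum.cong) auto
      also have "\<dots> = of_rat (q 2) * (l * U 1) + (\<Sum>j=2..<n. of_rat (q (Suc j)) * (l * U j))"
        using n2 by (subst sum.atLeast_Suc_lessThan) (auto simp: numeral_2_eq_2)
      also have "(\<Sum>j=2..<n. of_rat (q (Suc j)) * (l * U j)) = l * ?s"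
        unfolding sum_distrib_left by (intro sum.cong) (auto simp: mult_ac)
      finally have "of_rat (q 1) * l + (of_rat (q 2) * (l * U 1) + l * ?s) = 0"
        using zero by simp
      then have "l * (of_rat (q 1) + of_rat (q 2) * U 1 + ?s) = 0"
        by (simp only: distrib_left mult_ac add.assoc)
      then have sum0: "of_rat (q 1) + of_rat (q 2) * U 1 + ?s = 0"
        using l(2) by simp
      \<comment> \<open>This scaling makes the affine form equal to 0 or to exactly
        \<open>U 1\<close>, so its algebraicity needs no closure property of algebraic
        numbers.\<close>
      define t where "t = (if q 2 = 0 then 1 else - 1 / q 2)"
      have t: "t \<noteq> 0" by (simp add: t_def)
      have "of_rat (t * q 1) + (\<Sum>j=2..<n. of_rat (t * q (Suc j)) * ?b j) = of_rat t * (of_rat (q 1) + ?s)"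
        by (simp add: of_rat_mult sum_distrib_left distrib_left mult.assoc)
      also have "of_rat (q 1) + ?s = - (of_rat (q 2) * U 1)"
        using sum0 by (simp add: eq_neg_iff_add_eq_0 ac_simps)
      also have "of_rat t * - (of_rat (q 2) * U 1) = - (of_rat t * of_rat (q 2) * U 1)"
        by simp
      also have "\<dots> = (if q 2 = 0 then 0 else U 1)"
        by (simp add: t_def of_rat_divide of_rat_minus)
      finally have alg: "algebraic (of_rat (t * q 1) + (\<Sum>j=2..<n. of_rat (t * q (Suc j)) * ?b j))"
        using U1(1) by simp
      have q: "q (Suc j) = 0" if "j \<in> {2..<n}" for j
        using rat_alg_indep_on_affine_algebraic[OF indep _ _ alg that] t by simp
      then have "?s = 0" by (intro sum.neutral) auto
      with sum0 have sum0': "of_rat (q 1) + of_rat (q 2) * U 1 = 0" by simp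
      \<comment> \<open>Irrationality of \<open>U 1\<close> enters here: 1 and \<open>U 1\<close>
        are linearly independent over the rationals.\<close>
      have q2: "q 2 = 0"
      proof (rule ccontr)
        assume "q 2 \<noteq> 0"
        then have "U 1 = of_rat (- q 1 / q 2)"
          using sum0' by (simp add: of_rat_divide of_rat_minus field_simps add_eq_0_iff)
        then show False using U1(2) by auto
      qed
      with sum0' have "q 1 = 0" by simp
      moreover have "q i = 0" if "i \<noteq> 1" "i \<noteq> 2"
      proof -
        have "i - 1 \<in> {2..<n}" using that i by auto
        from q[OF this] show ?thesis using i by simp
      qed
      ultimately show ?thesis using q2 by blast
    qed
  qed simp
qed (use l in auto)

section \<open>Rational non-integer bases: the tower of height 2\<close>

text \<open>This is \<open>(u/v)^q = (p/q)^k\<close> with denominators cleared. For a prime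
  \<open>R\<close> dividing \<open>q\<close>, and hence not \<open>p\<close>, comparing
  multiplicities shows that \<open>q\<close> divides \<open>k\<close> times the multiplicity of
  \<open>R\<close> in \<open>q\<close>, hence that multiplicity itself. But it is positive and
  smaller than \<open>q\<close>.\<close>

lemma int_power_mult_neq:
  fixes p u v :: int and q k :: nat
  assumes pq: "coprime p (int q)" and kq: "coprime k q" and q: "q > 1"
    and nz: "u \<noteq> 0" "v \<noteq> 0" "p \<noteq> 0" "k \<noteq> 0"
  shows "u ^ q * int q ^ k \<noteq> p ^ k * v ^ q"
proof
  assume eq: "u ^ q * int q ^ k = p ^ k * v ^ q"
  obtain r where r: "prime r" "r dvd q"
    using prime_factor_nat[of q] q by auto
  define R where "R = int r"
  have R: "prime_elem R" "R dvd int q"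
    using r by (auto simp: R_def)
  have "\<not> R dvd p"
    using R pq by (metis coprime_common_divisor prime_elem_not_unit)
  then have "multiplicity R p = 0"
    by (rule not_dvd_imp_multiplicity_0)
  moreover have "multiplicity R (u ^ q * int q ^ k) = multiplicity R (p ^ k * v ^ q)"
    by (simp add: eq)
  ultimately have "q * multiplicity R u + k * multiplicity R (int q) = q * multiplicity R v"
    using R nz q
    by (simp add: prime_elem_multiplicity_mult_distrib prime_elem_multiplicity_power_distrib)
  then have "q dvd k * multiplicity R (int q)"
    by (metis dvd_add_right_iff dvd_triv_left)
  then have "q dvd multiplicity R (int q)"
    using kq by (simp add: coprime_commute coprime_dvd_mult_right_iff)
  moreover have "multiplicity R (int q) > 0"
    using R q by (simp add: prime_elem_multiplicity_eq_zero_iff zero_less_iff_neq_zero)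
  ultimately have le: "q \<le> multiplicity R (int q)"
    by (rule dvd_imp_le)
  \<comment> \<open>A multiplicity of at least \<open>q\<close> would make a prime power exceeding
    \<open>q\<close> divide \<open>q\<close>.\<close>
  have "q < 2 ^ q" by simp
  also have "(2::nat) ^ q \<le> r ^ q"
    using prime_ge_2_nat[OF r(1)] by (rule power_mono) simp
  also have "\<dots> \<le> r ^ multiplicity R (int q)"
    using prime_ge_2_nat[OF r(1)] le by (intro power_increasing) auto
  also have "\<dots> \<le> q"
  proof (rule dvd_imp_le)
    have "R ^ multiplicity R (int q) dvd int q" by (rule multiplicity_dvd)
    then have "int (r ^ multiplicity R (int q)) dvd int q" by (simp add: R_def)
    then show "r ^ multiplicity R (int q) dvd q" by (simp only: int_dvd_int_iff)
  qed (use q in simp)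
  finally show False by simp
qed

text \<open>With \<open>a = p/q\<close> in lowest terms, the \<open>q\<close>-th power of
  \<open>exp (l * a)\<close> is \<open>a\<close> to the integer power \<open>p\<close>, whichever
  logarithm \<open>l\<close> is. This rational number has no rational \<open>q\<close>-th root, by
  the multiplicity argument.\<close>

lemma exp_mult_self_algebraic_irrational:
  assumes a: "a \<in> \<rat>" "a \<notin> \<int>" and l: "exp l = (a :: complex)"
  shows "algebraic (exp (l * a))" "exp (l * a) \<notin> \<rat>"
proof -
  obtain r where r: "a = of_rat r" using a(1) by (auto elim: Rats_cases)
  obtain p d where pd: "quotient_of r = (p, d)" by force
  define q where "q = nat d"
  have d: "d = int q" "coprime p (int q)" "q > 0"
    using quotient_of_denom_pos[OF pd] quotient_of_coprime[OF pd] by (auto simp: q_def)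
  have a_eq: "a = of_int p / of_nat q"
    using quotient_of_div[OF pd] by (simp add: r d(1) of_rat_divide)
  have q: "q > 1"
  proof (rule ccontr)
    assume "\<not> q > 1"
    then have "q = 1" using d(3) by simp
    then show False using a(2) a_eq by simp
  qed
  have p: "p \<noteq> 0" using a(2) a_eq by auto
  \<comment> \<open>The natural exponent \<open>k\<close> stands for the absolute value of
    \<open>p\<close>; negative \<open>p\<close> gives the inverse power.\<close>
  define k where "k = nat \<bar>p\<bar>"
  have k: "k \<noteq> 0" "coprime k q"
    using p d(2) by (auto simp: k_def simp flip: coprime_int_iff)
  let ?z = "exp (l * a)"
  have "?z ^ q = exp (of_int p * l)"
    using q by (simp add: exp_of_nat_mult[symmetric] a_eq field_simps)
  then have zq: "?z ^ q = (if p > 0 then a ^ k else inverse (a ^ k))"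
    by (auto simp: k_def exp_of_nat_mult[symmetric] l[symmetric] simp flip: exp_minus)
  then have "?z ^ q \<in> \<rat>" using a(1) by auto
  then have "algebraic (?z ^ q)" by (rule rat_imp_algebraic)
  then show "algebraic ?z"
    by (rule algebraic_root[where p = "monom 1 q"])
      (use q in \<open>simp_all add: poly_monom degree_monom_eq\<close>)
  show "?z \<notin> \<rat>"
  proof
    assume "?z \<in> \<rat>"
    then obtain s where s: "?z = of_rat s" by (auto elim: Rats_cases)
    obtain u v where uv: "quotient_of s = (u, v)" by force
    have v: "v \<noteq> 0" using quotient_of_denom_pos[OF uv] by simp
    have z_eq: "?z = of_int u / of_int v"
      using quotient_of_div[OF uv] by (simp add: s of_rat_divide)
    have u: "u \<noteq> 0" using z_eq by auto
    show False
    proof (cases "p > 0")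
      case True
      have "(of_int u / of_int v) ^ q = ?z ^ q" by (simp only: z_eq)
      also have "\<dots> = a ^ k" using zq True by (simp only: if_True)
      finally have "(of_int u / of_int v) ^ q = (of_int p / of_nat q :: complex) ^ k"
        by (simp only: a_eq)
      then have "(of_int (u ^ q * int q ^ k) :: complex) = of_int (p ^ k * v ^ q)"
        using q v by (simp add: power_divide field_simps)
      then show False
        using int_power_mult_neq[OF d(2) k(2) q u v p k(1)] by (simp only: of_int_eq_iff)
    next
      case False
      have "(of_int u / of_int v) ^ q = ?z ^ q" by (simp only: z_eq)
      also have "\<dots> = inverse (a ^ k)" using zq False by (simp only: if_False)
      finally have "(of_int u / of_int v) ^ q = inverse ((of_int p / of_nat q :: complex) ^ k)"
        by (simp only: a_eq)
      \<comment> \<open>Inverting both sides exchanges \<open>u\<close> and \<open>v\<close>, which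
        reduces to the same inequality.\<close>
      then have "(of_int (v ^ q * int q ^ k) :: complex) = of_int (p ^ k * u ^ q)"
        using q v p by (simp add: power_divide field_simps)
      then show False
        using int_power_mult_neq[OF d(2) k(2) q v u p k(1)] by (simp only: of_int_eq_iff)
    qed
  qed
qed

section \<open>Assembling the three statements\<close>

lemma SSC_log_and_towers:
  assumes SSC: Schanuel_Subset_Conjecture
    and a: "algebraic a" "a \<notin> \<int>" and l: "exp l = a"
  shows "rat_alg_indep_on UNIV (\<lambda>j::nat. case j of 0 \<Rightarrow> l | Suc i \<Rightarrow> power_tower l (i + 3))"
proof (cases "a \<in> \<rat>")
  case False
  have "l \<noteq> 0" using a(2) l by auto
  then have "rat_alg_indep_on {1..} (\<lambda>k. if k = 1 then l else power_tower l k)"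
    using a False l by (intro SSC_tower_irrational_start[OF SSC]) auto
  then show ?thesis
    \<comment> \<open>Slot 1 holds \<open>l\<close>; index 2 is skipped, because the family common
      to both cases omits the tower of height 2.\<close>
    by (rule rat_alg_indep_on_reindex[where f = "\<lambda>j. case j of 0 \<Rightarrow> 1 | Suc i \<Rightarrow> i + 3"])
      (auto simp: inj_on_def split: nat.splits)
next
  case True
  have "l \<noteq> 0" using a(2) l by auto
  \<comment> \<open>Here \<open>U k\<close> is the tower of height \<open>k + 1\<close>, so
    \<open>U 1 = exp (l * a)\<close> is the irrational algebraic start.\<close>
  then have "rat_alg_indep_on {1..} (\<lambda>k. if k = 1 then l else power_tower l (Suc k))"
    using a l exp_mult_self_algebraic_irrational[OF True a(2) l]
    by (intro SSC_tower_irrational_start[OF SSC]) auto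
  then show ?thesis
    by (rule rat_alg_indep_on_reindex[where f = Suc])
      (auto simp: numeral_3_eq_3 split: nat.splits)
qed

theorem theorem1:
  assumes "Schanuel_Subset_Conjecture"
  shows
    "(\<forall>\<omega>::complex. algebraic \<omega> \<longrightarrow> \<omega> \<noteq> 0 \<longrightarrow>
        (\<forall>k\<ge>2. \<not> algebraic (power_tower \<omega> k)) \<and>
        rat_alg_indep_on {1..} (power_tower \<omega>)) \<and>
     (\<forall>\<alpha> l :: complex. algebraic \<alpha> \<longrightarrow> \<alpha> \<notin> \<rat> \<longrightarrow> exp l = \<alpha> \<longrightarrow>
        (\<forall>k\<ge>2. \<not> algebraic (power_tower l k)) \<and>
        rat_alg_indep_on {2..} (power_tower l)) \<and>
     (\<forall>\<alpha> l :: complex. algebraic \<alpha> \<longrightarrow> \<alpha> \<notin> \<int> \<longrightarrow> exp l = \<alpha> \<longrightarrow>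
        (\<forall>m\<ge>3. \<not> algebraic (power_tower l m)) \<and>
        rat_alg_indep_on UNIV (\<lambda>j::nat. case j of 0 \<Rightarrow> l | Suc i \<Rightarrow> power_tower l (i + 3)))"
proof (intro conjI allI impI)
  fix w :: complex assume w: "algebraic w" "w \<noteq> 0"
  show indep: "rat_alg_indep_on {1..} (power_tower w)"
    using SSC_tower_algebraic_exponent assms w by blast
  fix k :: nat assume "2 \<le> k"
  then show "\<not> algebraic (power_tower w k)"
    using rat_alg_indep_on_imp_not_algebraic[OF indep] by simp
next
  fix a l :: complex assume a: "algebraic a" "a \<notin> \<rat>" "exp l = a"
  then have "l \<noteq> 0" by auto
  with a have "rat_alg_indep_on {1..} (\<lambda>k. if k = 1 then l else power_tower l k)"
    by (intro SSC_tower_irrational_start[OF assms]) auto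
  \<comment> \<open>Restricting to indices from 2 on discards the slot of \<open>l\<close>.\<close>
  then show indep: "rat_alg_indep_on {2..} (power_tower l)"
    by (rule rat_alg_indep_on_reindex[where f = id]) auto
  fix k :: nat assume "2 \<le> k"
  then show "\<not> algebraic (power_tower l k)"
    using rat_alg_indep_on_imp_not_algebraic[OF indep] by simp
next
  fix a l :: complex assume a: "algebraic a" "a \<notin> \<int>" "exp l = a"
  show indep: "rat_alg_indep_on UNIV (\<lambda>j::nat. case j of 0 \<Rightarrow> l | Suc i \<Rightarrow> power_tower l (i + 3))"
    using SSC_log_and_towers[OF assms a] .
  fix m :: nat assume "3 \<le> m"
  then show "\<not> algebraic (power_tower l m)"
    using rat_alg_indep_on_imp_not_algebraic[OF indep, of "Suc (m - 3)"] by simp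
qed

end
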